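(* Let $K=K(S_1,S_2)$ be an oriented generic pair of immersions and let $K^{*}$ be the pair obtained from $K$ by reversing the orientations of both immersions simultaneously. Then $J^{2+}(K^{*})=J^{2+}(K)$.
   Context: An immersion is a smooth map $S:S^1\to\mathbb{C}$ with nowhere vanishing derivative; $S$ also denotes its image, and it is oriented by its parametrization. A pair of immersions $K=K(S_1,S_2)$ is a map $K:S^1\sqcup S^1\to\mathbb{C}$ given by two immersions $S_1,S_2$ on the two circles; $K$ also denotes the image $S_1\cup S_2$. The pair is generic if its only singularities are transverse double points (self-intersections of $S_1$ or of $S_2$, or intersections of $S_1$ with $S_2$). For a connected component $C$ of $\mathbb{C}\setminus K$, $\omega_C(K)$ is the winding number of $K$ around any point of $C$, i.e. the sum of the winding numbers of $S_1$ and $S_2$. For a double point $p$, $ind_p(K)$ is the arithmetic mean of the winding numbers of the four components (quadrants, counted with multiplicity) adjacent to $p$. The encircling index is $u(K)=0$ if $S_1\cap S_2\neq\emptyset$, and otherwise $u(K)=\omega_{C_1}(S_2)+\omega_{C_2}(S_1)$, where $C_1$ is the component of $\mathbb{C}\setminus S_2$ containing $S_1$ and $C_2$ is the component of $\mathbb{C}\setminus S_1$ containing $S_2$. With $n$ the number of double points of $K$, $$J^{2+}(K):=2+n-\sum_{C\subset\mathbb{C}\setminus K}\omega_C(K)^2+\sum_p ind_p(K)^2+u(K)^2 .$$ *)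

theory Defs
  imports "HOL-Complex_Analysis.Complex_Analysis"
begin

abbreviation circle :: "complex set" where
  "circle \<equiv> sphere 0 1"

section \<open>Immersions of the circle\<close>

text \<open>A map on the circle is given by a function on the whole complex plane of which only the
  values on \<^term>\<open>circle\<close> are ever used.\<close>

definition smooth_curve :: "(real \<Rightarrow> complex) \<Rightarrow> bool" where
  "smooth_curve f \<longleftrightarrow>
     (\<exists>D. D 0 = f \<and> (\<forall>n t. (D n has_vector_derivative D (Suc n) t) (at t)))"

text \<open>Derivative of \<open>S\<close> at \<open>x\<close> with respect to the positively oriented angular parameter.\<close>

definition circle_tangent :: "(complex \<Rightarrow> complex) \<Rightarrow> complex \<Rightarrow> complex" where
  "circle_tangent S x = vector_derivative (\<lambda>t. S (x * cis t)) (at 0)"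

definition circle_immersion :: "(complex \<Rightarrow> complex) \<Rightarrow> bool" where
  "circle_immersion S \<longleftrightarrow>
     smooth_curve (\<lambda>t. S (cis t)) \<and> (\<forall>x\<in>circle. circle_tangent S x \<noteq> 0)"

definition circle_loop :: "(complex \<Rightarrow> complex) \<Rightarrow> real \<Rightarrow> complex" where
  "circle_loop S t = S (cis (2 * pi * t))"

text \<open>Orientation reversal: precomposition with the reflection of the circle.\<close>

definition reverse_orientation :: "(complex \<Rightarrow> complex) \<Rightarrow> complex \<Rightarrow> complex" where
  "reverse_orientation S = S \<circ> cnj"

section \<open>Generic pairs\<close>

text \<open>The pair \<open>K(S\<^sub>1, S\<^sub>2)\<close> is the map \<^term>\<open>case_sum S1 S2\<close> on the disjoint union
  \<^term>\<open>circle <+> circle\<close>.\<close>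

definition pair_image :: "(complex \<Rightarrow> complex) \<Rightarrow> (complex \<Rightarrow> complex) \<Rightarrow> complex set" where
  "pair_image S1 S2 = case_sum S1 S2 ` (circle <+> circle)"

definition pair_fibre ::
    "(complex \<Rightarrow> complex) \<Rightarrow> (complex \<Rightarrow> complex) \<Rightarrow> complex \<Rightarrow> (complex + complex) set" where
  "pair_fibre S1 S2 p = {x \<in> circle <+> circle. case_sum S1 S2 x = p}"

definition pair_tangent ::
    "(complex \<Rightarrow> complex) \<Rightarrow> (complex \<Rightarrow> complex) \<Rightarrow> complex + complex \<Rightarrow> complex" where
  "pair_tangent S1 S2 = case_sum (circle_tangent S1) (circle_tangent S2)"

definition double_points :: "(complex \<Rightarrow> complex) \<Rightarrow> (complex \<Rightarrow> complex) \<Rightarrow> complex set" where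
  "double_points S1 S2 = {p. card (pair_fibre S1 S2 p) = 2}"

text \<open>Here \<^const>\<open>span\<close> is the span over the reals. By compactness, a generic pair
  has only finitely many double points, and its complement finitely many components.\<close>

definition generic_pair :: "(complex \<Rightarrow> complex) \<Rightarrow> (complex \<Rightarrow> complex) \<Rightarrow> bool" where
  "generic_pair S1 S2 \<longleftrightarrow>
     circle_immersion S1 \<and> circle_immersion S2 \<and>
     (\<forall>p. finite (pair_fibre S1 S2 p) \<and> card (pair_fibre S1 S2 p) \<le> 2) \<and>
     (\<forall>p. \<forall>x\<in>pair_fibre S1 S2 p. \<forall>y\<in>pair_fibre S1 S2 p. x \<noteq> y \<longrightarrow>
        span {pair_tangent S1 S2 x, pair_tangent S1 S2 y} = UNIV)"

section \<open>Indices\<close>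

text \<open>The common winding number of \<open>S\<close> around the points of \<open>C\<close>, for a connected nonempty
  set \<open>C\<close> disjoint from the image of \<open>S\<close>.\<close>

definition region_winding :: "(complex \<Rightarrow> complex) \<Rightarrow> complex set \<Rightarrow> int" where
  "region_winding S C = (THE n. \<forall>z\<in>C. winding_number (circle_loop S) z = of_int n)"

definition pair_winding :: "(complex \<Rightarrow> complex) \<Rightarrow> (complex \<Rightarrow> complex) \<Rightarrow> complex set \<Rightarrow> int" where
  "pair_winding S1 S2 C = region_winding S1 C + region_winding S2 C"

text \<open>Let \<open>v\<close> and \<open>w\<close> be the tangent vectors of the two branches at a double point \<open>p\<close>. The four
  quadrants at \<open>p\<close> are the sectors containing the directions \<open>\<plusminus> v \<plusminus> w\<close>; they are indexed by the
  assignments \<open>s\<close> of a sign to each of the two preimages of \<open>p\<close>. The region of a quadrant is the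
  component containing all points close to \<open>p\<close> on the ray from \<open>p\<close> in this direction.\<close>

definition quadrant_signs ::
    "(complex \<Rightarrow> complex) \<Rightarrow> (complex \<Rightarrow> complex) \<Rightarrow> complex \<Rightarrow> (complex + complex \<Rightarrow> real) set" where
  "quadrant_signs S1 S2 p = (\<Pi>\<^sub>E x\<in>pair_fibre S1 S2 p. {1, -1})"

definition quadrant_region ::
    "(complex \<Rightarrow> complex) \<Rightarrow> (complex \<Rightarrow> complex) \<Rightarrow> complex \<Rightarrow> (complex + complex \<Rightarrow> real)
      \<Rightarrow> complex set" where
  "quadrant_region S1 S2 p s =
     (THE C. C \<in> components (- pair_image S1 S2) \<and>
        (\<forall>\<^sub>F r in at_right (0::real).
           p + r *\<^sub>R (\<Sum>x\<in>pair_fibre S1 S2 p. s x *\<^sub>R pair_tangent S1 S2 x) \<in> C))"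

definition double_point_index ::
    "(complex \<Rightarrow> complex) \<Rightarrow> (complex \<Rightarrow> complex) \<Rightarrow> complex \<Rightarrow> real" where
  "double_point_index S1 S2 p =
     (\<Sum>s\<in>quadrant_signs S1 S2 p. real_of_int (pair_winding S1 S2 (quadrant_region S1 S2 p s))) / 4"

definition encircling_index :: "(complex \<Rightarrow> complex) \<Rightarrow> (complex \<Rightarrow> complex) \<Rightarrow> int" where
  "encircling_index S1 S2 =
     (if S1 ` circle \<inter> S2 ` circle \<noteq> {} then 0
      else region_winding S2 (THE C. C \<in> components (- (S2 ` circle)) \<and> S1 ` circle \<subseteq> C) +
           region_winding S1 (THE C. C \<in> components (- (S1 ` circle)) \<and> S2 ` circle \<subseteq> C))"

definition J2plus :: "(complex \<Rightarrow> complex) \<Rightarrow> (complex \<Rightarrow> complex) \<Rightarrow> real" where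
  "J2plus S1 S2 =
     2 + real (card (double_points S1 S2))
       - (\<Sum>C\<in>components (- pair_image S1 S2). (real_of_int (pair_winding S1 S2 C))\<^sup>2)
       + (\<Sum>p\<in>double_points S1 S2. (double_point_index S1 S2 p)\<^sup>2)
       + (real_of_int (encircling_index S1 S2))\<^sup>2"

end

theory Submission
  imports Defs
begin

text \<open>Reversing both orientations changes neither the images of the curves nor, therefore, the
  regions, the double points and the quadrants; it negates every tangent vector and every winding
  number. All terms of \<open>J\<^sup>2\<^sup>+\<close> are even in the winding numbers, so the sum is unchanged.

  Winding numbers of a region change sign only if the region really is a connected nonempty
  set off the curves. This is clear for the components of the complement and for the components
  entering the encircling index. For the quadrants it requires that, at a double point \<open>p\<close> with
  tangent vectors \<open>v\<close> and \<open>w\<close>, each of the four rays in the directions \<open>\<plusminus> v \<plusminus> w\<close> avoids the image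
  near \<open>p\<close>, and so runs inside one component there. By transversality, a branch through \<open>p\<close> is
  not tangent to such a ray, hence leaves the line of the ray at once
  (\<open>eventually_ray_avoids_curve\<close>); compactness disposes of the rest of the curve.

  At \<open>p\<close>, the preimages of the reversed pair are the conjugates of the original ones, with
  opposite tangents. Flipping all signs thus matches the quadrants of the two pairs so that
  corresponding ones are the same region, with opposite winding number.\<close>

section \<open>Immersions and reversal of orientation\<close>

lemma immersion_has_vector_derivative:
  assumes "circle_immersion S"
  shows "((\<lambda>t. S (cis t)) has_vector_derivative circle_tangent S (cis t)) (at t)"
proof -
  obtain D where "((\<lambda>t. S (cis t)) has_vector_derivative D t) (at t)" for t
    using assms unfolding circle_immersion_def smooth_curve_def by metis
  then have D: "((\<lambda>t. S (cis t)) has_vector_derivative D t) (at (t + 0))" by simp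
  have "((\<lambda>h. S (cis (t + h))) has_vector_derivative D t) (at 0)"
    using vector_diff_chain_at[of "\<lambda>h. t + h" 1 0 "\<lambda>t. S (cis t)" "D t"] D
      has_vector_derivative_add[OF has_vector_derivative_const[of t] has_vector_derivative_id[of "at 0"]]
    by (simp add: o_def)
  then have "circle_tangent S (cis t) = D t"
    unfolding circle_tangent_def by (simp add: cis_mult vector_derivative_at)
  with D show ?thesis by simp
qed

lemma continuous_on_immersion:
  assumes "circle_immersion S"
  shows "continuous_on A (\<lambda>t. S (cis t))"
  using immersion_has_vector_derivative[OF assms]
  by (meson has_vector_derivative_continuous continuous_at_imp_continuous_on)

lemma circle_eq_image_cis: "circle = cis ` {0..2 * pi}"
proof -
  have "x \<in> cis ` {0..2 * pi}" if "norm x = 1" for x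
    using that complex_unimodular_polar[of x]
    by (metis atLeastAtMost_iff cis.sel complex_eqI complex.sel image_eqI less_eq_real_def)
  then show ?thesis by auto
qed

lemma immersion_image: "S ` circle = (\<lambda>t. S (cis t)) ` {0..2 * pi}"
  by (simp add: circle_eq_image_cis image_image)

lemma
  assumes "circle_immersion S"
  shows compact_immersion_image: "compact (S ` circle)"
    and connected_immersion_image: "connected (S ` circle)"
  unfolding immersion_image
  by (auto intro!: compact_continuous_image connected_continuous_image
      continuous_on_immersion[OF assms])

lemma
  assumes "circle_immersion S"
  shows path_circle_loop: "path (circle_loop S)"
    and pathfinish_circle_loop: "pathfinish (circle_loop S) = pathstart (circle_loop S)"
    and path_image_circle_loop: "path_image (circle_loop S) \<subseteq> S ` circle"
proof -
  have "continuous_on {0..1} ((\<lambda>t. S (cis t)) \<circ> (\<lambda>t. 2 * pi * t))"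
    by (intro continuous_on_compose continuous_on_immersion[OF assms] continuous_intros)
  then show "path (circle_loop S)"
    by (simp add: path_def circle_loop_def[abs_def] o_def)
qed (auto simp: pathfinish_def pathstart_def path_image_def circle_loop_def)

lemma circle_loop_reverse: "circle_loop (reverse_orientation S) = reversepath (circle_loop S)"
proof
  fix t
  have "cis (2 * pi * (1 - t)) = cnj (cis (2 * pi * t))"
    by (simp add: cis_cnj right_diff_distrib flip: cis_divide cis_inverse) (simp add: divide_inverse)
  then show "circle_loop (reverse_orientation S) t = reversepath (circle_loop S) t"
    by (simp add: circle_loop_def reverse_orientation_def reversepath_def)
qed

lemma cnj_image_circle: "cnj ` circle = circle"
proof -
  have "x \<in> cnj ` circle" if "x \<in> circle" for x
    using that by (intro image_eqI[of _ _ "cnj x"]) auto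
  then show ?thesis by auto
qed

lemma reverse_image: "reverse_orientation S ` circle = S ` circle"
  unfolding reverse_orientation_def image_comp[symmetric] cnj_image_circle ..

lemma circle_tangent_reverse:
  assumes "circle_immersion S" "x \<in> circle"
  shows "circle_tangent (reverse_orientation S) x = - circle_tangent S (cnj x)"
proof -
  obtain a where x: "cnj x = cis a"
    using assms(2) circle_eq_image_cis cnj_image_circle by (metis imageE imageI)
  have "((\<lambda>t. S (cis t)) \<circ> (\<lambda>h. a - h) has_vector_derivative
      (-1) *\<^sub>R circle_tangent S (cis a)) (at 0)"
    using immersion_has_vector_derivative[OF assms(1), of a]
    by (intro vector_diff_chain_at) (auto intro!: derivative_eq_intros)
  moreover have "reverse_orientation S (x * cis h) = S (cis (a - h))" for h
    by (simp add: reverse_orientation_def x cis_cnj cis_mult)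
  ultimately show ?thesis
    unfolding circle_tangent_def[of "reverse_orientation S"]
    by (simp add: o_def x vector_derivative_at)
qed

section \<open>Winding numbers of regions\<close>

lemma region_winding_eqI:
  assumes "C \<noteq> {}" "\<And>z. z \<in> C \<Longrightarrow> winding_number (circle_loop S) z = of_int n"
  shows "region_winding S C = n"
  unfolding region_winding_def
proof (rule the_equality)
  fix m assume "\<forall>z\<in>C. winding_number (circle_loop S) z = of_int m"
  with assms show "m = n" by (metis of_int_eq_iff ex_in_conv)
qed (use assms in auto)

lemma region_winding_reverse:
  assumes S: "circle_immersion S"
    and C: "connected C" "C \<noteq> {}" "C \<inter> S ` circle = {}"
  shows "region_winding (reverse_orientation S) C = - region_winding S C"
proof -
  note loop = path_circle_loop[OF S] pathfinish_circle_loop[OF S]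
  have off: "z \<notin> path_image (circle_loop S)" if "z \<in> C" for z
    using that C(3) path_image_circle_loop[OF S] by blast
  have "(\<lambda>z. winding_number (circle_loop S) z) constant_on C"
    using off by (intro winding_number_constant loop C) auto
  moreover obtain z0 where z0: "z0 \<in> C" using C(2) by blast
  moreover have "winding_number (circle_loop S) z0 \<in> \<int>"
    by (intro integer_winding_number loop off z0)
  ultimately obtain n where n: "\<And>z. z \<in> C \<Longrightarrow> winding_number (circle_loop S) z = of_int n"
    unfolding constant_on_def Ints_def by (metis imageE)
  have "winding_number (circle_loop (reverse_orientation S)) z = of_int (- n)" if "z \<in> C" for z
    using that by (simp add: circle_loop_reverse winding_number_reversepath loop off n)
  then show ?thesis
    using region_winding_eqI[OF C(2)] n by metis
qed

lemma pair_image_eq: "pair_image S1 S2 = S1 ` circle \<union> S2 ` circle"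
  by (auto simp: pair_image_def Plus_def image_Un image_image)

lemma pair_winding_reverse:
  assumes "circle_immersion S1" "circle_immersion S2" "C \<in> components (- pair_image S1 S2)"
  shows "pair_winding (reverse_orientation S1) (reverse_orientation S2) C = - pair_winding S1 S2 C"
proof -
  have "connected C" "C \<noteq> {}" "C \<subseteq> - pair_image S1 S2"
    using assms(3) in_components_connected in_components_nonempty in_components_subset by metis+
  then show ?thesis
    using assms(1,2) unfolding pair_winding_def pair_image_eq
    by (subst (1 2) region_winding_reverse) auto
qed

lemma ex1_component_containing:
  assumes "connected T" "T \<noteq> {}" "T \<subseteq> U"
  shows "\<exists>!C. C \<in> components U \<and> T \<subseteq> C"
proof -
  obtain a where a: "a \<in> T" using assms by blast
  have "connected_component_set U a \<in> components U \<and> T \<subseteq> connected_component_set U a"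
    using a assms by (auto intro: componentsI dest: connected_component_maximal)
  moreover have "C = D" if "C \<in> components U" "D \<in> components U" "T \<subseteq> C" "T \<subseteq> D" for C D
    using that a components_eq[of C U D] by blast
  ultimately show ?thesis by blast
qed

lemma encircling_winding_reverse:
  assumes "circle_immersion S" "circle_immersion T" "T ` circle \<inter> S ` circle = {}"
  defines "C \<equiv> THE C. C \<in> components (- (S ` circle)) \<and> T ` circle \<subseteq> C"
  shows "region_winding (reverse_orientation S) C = - region_winding S C"
proof -
  have "T ` circle \<noteq> {}" by (simp add: circle_eq_image_cis)
  moreover have "T ` circle \<subseteq> - (S ` circle)" using assms(3) by blast
  ultimately have "\<exists>!C. C \<in> components (- (S ` circle)) \<and> T ` circle \<subseteq> C"
    by (intro ex1_component_containing connected_immersion_image assms(2))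
  from theI'[OF this] have C: "C \<in> components (- (S ` circle))"
    unfolding C_def by (rule conjunct1)
  have "C \<inter> S ` circle = {}" using in_components_subset[OF C] by blast
  then show ?thesis
    by (intro region_winding_reverse assms(1) in_components_connected[OF C]
        in_components_nonempty[OF C])
qed

lemma encircling_index_reverse:
  assumes "circle_immersion S1" "circle_immersion S2"
  shows "(encircling_index (reverse_orientation S1) (reverse_orientation S2))\<^sup>2
    = (encircling_index S1 S2)\<^sup>2"
proof (cases "S1 ` circle \<inter> S2 ` circle = {}")
  case True
  then have "encircling_index (reverse_orientation S1) (reverse_orientation S2)
      = - encircling_index S1 S2"
    using encircling_winding_reverse[OF assms] encircling_winding_reverse[OF assms(2,1)]
    by (simp add: encircling_index_def reverse_image Int_commute)
  then show ?thesis by simp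
qed (simp add: encircling_index_def reverse_image)

section \<open>Quadrants\<close>

text \<open>A ray from \<open>p\<close> in a direction to which no branch of the curve through \<open>p\<close> is tangent avoids
  the curve near \<open>p\<close>. For complex \<open>d\<close> and \<open>v\<close>, the determinant of the pair \<open>(d, v)\<close> is
  \<^term>\<open>Im (cnj d * v)\<close>.\<close>

lemma eventually_ray_avoids_curve:
  fixes f :: "real \<Rightarrow> complex"
  assumes "compact A" "d \<noteq> 0"
    and f: "\<And>t. t \<in> A \<Longrightarrow> (f has_vector_derivative f' t) (at t)"
    and transverse: "\<And>t. t \<in> A \<Longrightarrow> f t = p \<Longrightarrow> Im (cnj d * f' t) \<noteq> 0"
  shows "\<forall>\<^sub>F r in at_right 0. p + r *\<^sub>R d \<notin> f ` A"
proof -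
  have local: "\<exists>U. open U \<and> t \<in> U \<and> (\<forall>\<^sub>F r in at_right 0. \<forall>u\<in>U. f u \<noteq> p + r *\<^sub>R d)"
    if t: "t \<in> A" for t
  proof (cases "f t = p")
    case True
    \<comment> \<open>This function of \<open>u\<close> vanishes exactly when \<open>f u\<close> lies on the line of the ray, and \<open>t\<close> is an
      isolated zero of it.\<close>
    have "((\<lambda>u. Im (cnj d * (f u - p))) has_vector_derivative Im (cnj d * f' t)) (at t)"
      by (intro bounded_linear.has_vector_derivative[OF bounded_linear_Im])
        (use f[OF t] in \<open>auto intro!: derivative_eq_intros\<close>)
    then have "((\<lambda>u. Im (cnj d * (f u - p))) has_real_derivative Im (cnj d * f' t)) (at t)"
      by (simp add: has_real_derivative_iff_has_vector_derivative)
    then have "((\<lambda>u. Im (cnj d * (f u - p)) / (u - t)) \<longlongrightarrow> Im (cnj d * f' t)) (at t)"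
      using True by (simp add: has_field_derivative_iff)
    then have "\<forall>\<^sub>F u in at t. Im (cnj d * (f u - p)) / (u - t) \<noteq> 0"
      by (rule tendsto_imp_eventually_ne) (use transverse[OF t True] in simp)
    then obtain U where U: "open U" "t \<in> U"
      "\<And>u. u \<in> U \<Longrightarrow> u \<noteq> t \<Longrightarrow> Im (cnj d * (f u - p)) \<noteq> 0"
      by (auto simp: eventually_at_topological)
    have "f u \<noteq> p + r *\<^sub>R d" if "u \<in> U" "r > 0" for u r
    proof
      assume eq: "f u = p + r *\<^sub>R d"
      then have "Im (cnj d * (f u - p)) = 0" by (simp add: algebra_simps)
      with U(3) that have "u = t" by blast
      with eq True that assms(2) show False by simp
    qed
    then have "\<forall>\<^sub>F r in at_right 0. \<forall>u\<in>U. f u \<noteq> p + r *\<^sub>R d"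
      by (intro eventually_at_right_less[THEN eventually_mono]) auto
    with U show ?thesis by blast
  next
    case False
    then obtain V W where VW: "open V" "open W" "f t \<in> V" "p \<in> W" "V \<inter> W = {}"
      by (meson hausdorff)
    have "isCont f t" using f[OF t] by (rule has_vector_derivative_continuous)
    then obtain U where U: "open U" "t \<in> U" "\<And>u. u \<in> U \<Longrightarrow> f u \<in> V"
      using VW by (metis continuous_at_open)
    have "((\<lambda>r. p + r *\<^sub>R d) \<longlongrightarrow> p + 0 *\<^sub>R d) (at_right 0)"
      by (intro tendsto_intros)
    then have "\<forall>\<^sub>F r in at_right 0. p + r *\<^sub>R d \<in> W"
      using VW by (auto dest: topological_tendstoD)
    then have "\<forall>\<^sub>F r in at_right 0. \<forall>u\<in>U. f u \<noteq> p + r *\<^sub>R d"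
      by (rule eventually_mono) (use U VW in force)
    with U show ?thesis by blast
  qed
  then have "\<forall>t\<in>A. \<exists>U. open U \<and> t \<in> U \<and> (\<forall>\<^sub>F r in at_right 0. \<forall>u\<in>U. f u \<noteq> p + r *\<^sub>R d)"
    by blast
  from bchoice[OF this] obtain U where U: "\<And>t. t \<in> A \<Longrightarrow> open (U t)" "\<And>t. t \<in> A \<Longrightarrow> t \<in> U t"
    "\<And>t. t \<in> A \<Longrightarrow> \<forall>\<^sub>F r in at_right 0. \<forall>u\<in>U t. f u \<noteq> p + r *\<^sub>R d"
    by blast
  obtain B where B: "B \<subseteq> A" "finite B" "A \<subseteq> (\<Union>t\<in>B. U t)"
    using compactE_image[OF assms(1), of A U] U by blast
  then have "\<forall>\<^sub>F r in at_right 0. \<forall>t\<in>B. \<forall>u\<in>U t. f u \<noteq> p + r *\<^sub>R d"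
    using U(3) by (intro eventually_ball_finite) auto
  then show ?thesis
    by (rule eventually_mono) (use B in force)
qed

lemma eventually_ray_avoids_immersion:
  assumes "circle_immersion S" "d \<noteq> 0"
    and "\<And>x. x \<in> circle \<Longrightarrow> S x = p \<Longrightarrow> Im (cnj d * circle_tangent S x) \<noteq> 0"
  shows "\<forall>\<^sub>F r in at_right 0. p + r *\<^sub>R d \<notin> S ` circle"
  unfolding immersion_image
  by (rule eventually_ray_avoids_curve[where f' = "\<lambda>t. circle_tangent S (cis t)"])
    (use assms immersion_has_vector_derivative in auto)

lemma ex1_component_of_ray:
  fixes p d :: complex
  assumes "\<forall>\<^sub>F r in at_right (0::real). p + r *\<^sub>R d \<in> U"
  shows "\<exists>!C. C \<in> components U \<and> (\<forall>\<^sub>F r in at_right 0. p + r *\<^sub>R d \<in> C)"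
proof -
  obtain b where b: "b > 0" "\<And>r. r > 0 \<Longrightarrow> r < b \<Longrightarrow> p + r *\<^sub>R d \<in> U"
    using assms by (auto simp: eventually_at_right_field)
  have "connected ((\<lambda>r. p + r *\<^sub>R d) ` {0<..<b})"
    by (intro connected_continuous_image continuous_intros) auto
  moreover have "(\<lambda>r. p + r *\<^sub>R d) ` {0<..<b} \<noteq> {}" "(\<lambda>r. p + r *\<^sub>R d) ` {0<..<b} \<subseteq> U"
    using b by auto
  ultimately obtain C where C: "C \<in> components U" "(\<lambda>r. p + r *\<^sub>R d) ` {0<..<b} \<subseteq> C"
    by (metis ex1_component_containing)
  then have "\<forall>\<^sub>F r in at_right 0. p + r *\<^sub>R d \<in> C"
    using b(1) by (auto simp: eventually_at_right_field image_subset_iff)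
  moreover have "D = E" if "D \<in> components U" "E \<in> components U"
    "\<forall>\<^sub>F r in at_right 0. p + r *\<^sub>R d \<in> D" "\<forall>\<^sub>F r in at_right 0. p + r *\<^sub>R d \<in> E" for D E
  proof -
    have "\<exists>r. p + r *\<^sub>R d \<in> D \<and> p + r *\<^sub>R d \<in> E"
      using eventually_happens[OF eventually_conj[OF that(3,4)]] by auto
    then show ?thesis using components_eq[OF that(1,2)] by blast
  qed
  ultimately show ?thesis using C(1) by blast
qed

lemma span_pair_UNIV_imp_det_nonzero:
  assumes "span {v, w :: complex} = UNIV"
  shows "Im (cnj v * w) \<noteq> 0"
proof
  assume 0: "Im (cnj v * w) = 0"
  have "v \<noteq> 0 \<or> w \<noteq> 0"
  proof (rule ccontr)
    assume "\<not> ?thesis"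
    then have "span {v, w} = {0}" by simp
    then show False using assms by (metis UNIV_I singletonD zero_neq_one)
  qed
  then obtain a where a: "a \<in> {v, w}" "a \<noteq> 0" by blast
  \<comment> \<open>This functional vanishes on \<open>v\<close> and \<open>w\<close>, hence everywhere, but not at \<open>\<i> * a\<close>.\<close>
  have lin: "linear (\<lambda>u. Im (cnj a * u))"
    by (auto intro!: linearI simp: algebra_simps)
  have "Im (cnj a * u) = 0" if "u \<in> {v, w}" for u
    using that a(1) 0 by (auto simp: algebra_simps)
  then have "Im (cnj a * (\<i> * a)) = 0"
    using linear_eq_0_on_span[OF lin, of "{v, w}"] assms by blast
  then have "(Re a)\<^sup>2 + (Im a)\<^sup>2 = 0" by (simp add: power2_eq_square)
  with a(2) show False by (simp add: complex_eq_iff sum_power2_eq_zero_iff)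
qed

text \<open>At a double point of a generic pair, the condition defining the region of a quadrant has
  exactly one solution.\<close>

lemma quadrant_region_in_components:
  assumes gen: "generic_pair S1 S2" and p: "p \<in> double_points S1 S2"
    and s: "s \<in> quadrant_signs S1 S2 p"
  shows "quadrant_region S1 S2 p s \<in> components (- pair_image S1 S2)"
proof -
  have imm: "circle_immersion S1" "circle_immersion S2"
    using gen by (auto simp: generic_pair_def)
  obtain x y where xy: "pair_fibre S1 S2 p = {x, y}" "x \<noteq> y"
    using p by (auto simp: double_points_def card_2_iff)
  define v w where "v = pair_tangent S1 S2 x" and "w = pair_tangent S1 S2 y"
  have "span {v, w} = UNIV"
    using gen xy unfolding generic_pair_def v_def w_def by blast
  then have det: "Im (cnj v * w) \<noteq> 0"
    by (rule span_pair_UNIV_imp_det_nonzero)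
  define d where "d = (\<Sum>x\<in>pair_fibre S1 S2 p. s x *\<^sub>R pair_tangent S1 S2 x)"
  have d: "d = s x *\<^sub>R v + s y *\<^sub>R w"
    using xy by (simp add: d_def v_def w_def)
  have sgn: "s x \<in> {1, -1}" "s y \<in> {1, -1}"
    using s xy by (auto simp: quadrant_signs_def PiE_iff)
  have "Im (cnj d * v) = - s y * Im (cnj v * w)" "Im (cnj d * w) = s x * Im (cnj v * w)"
    unfolding d by (auto simp: algebra_simps)
  then have trans: "Im (cnj d * v) \<noteq> 0" "Im (cnj d * w) \<noteq> 0"
    using det sgn by auto
  then have "d \<noteq> 0" by auto
  have tr: "Im (cnj d * pair_tangent S1 S2 z) \<noteq> 0" if "z \<in> pair_fibre S1 S2 p" for z
    using that trans xy by (auto simp: v_def w_def)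
  have "\<forall>\<^sub>F r in at_right 0. p + r *\<^sub>R d \<notin> S1 ` circle"
  proof (rule eventually_ray_avoids_immersion)
    fix x assume "x \<in> circle" "S1 x = p"
    then have "Inl x \<in> pair_fibre S1 S2 p"
      by (simp add: pair_fibre_def Plus_def image_iff)
    from tr[OF this] show "Im (cnj d * circle_tangent S1 x) \<noteq> 0"
      by (simp add: pair_tangent_def)
  qed (use imm \<open>d \<noteq> 0\<close> in auto)
  moreover have "\<forall>\<^sub>F r in at_right 0. p + r *\<^sub>R d \<notin> S2 ` circle"
  proof (rule eventually_ray_avoids_immersion)
    fix x assume "x \<in> circle" "S2 x = p"
    then have "Inr x \<in> pair_fibre S1 S2 p"
      by (simp add: pair_fibre_def Plus_def image_iff)
    from tr[OF this] show "Im (cnj d * circle_tangent S2 x) \<noteq> 0"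
      by (simp add: pair_tangent_def)
  qed (use imm \<open>d \<noteq> 0\<close> in auto)
  ultimately have "\<forall>\<^sub>F r in at_right 0. p + r *\<^sub>R d \<in> - pair_image S1 S2"
    by eventually_elim (simp add: pair_image_eq)
  from theI'[OF ex1_component_of_ray[OF this]] show ?thesis
    unfolding quadrant_region_def d_def by blast
qed

section \<open>Double points under reversal\<close>

text \<open>The identification of the preimages of a point under a pair and under the reversed pair.\<close>

abbreviation conj_point :: "complex + complex \<Rightarrow> complex + complex" where
  "conj_point \<equiv> map_sum cnj cnj"

lemma conj_point_conj_point [simp]: "conj_point (conj_point x) = x"
  by (cases x) auto

lemma inj_conj_point: "inj_on conj_point A"
  by (metis inj_on_def conj_point_conj_point)

lemma conj_point_in_fibre_iff:
  "conj_point x \<in> pair_fibre S1 S2 p \<longleftrightarrow>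
    x \<in> pair_fibre (reverse_orientation S1) (reverse_orientation S2) p"
  by (cases x) (auto simp: pair_fibre_def reverse_orientation_def)

lemma pair_fibre_reverse:
  "pair_fibre (reverse_orientation S1) (reverse_orientation S2) p
    = conj_point ` pair_fibre S1 S2 p"
proof -
  have "x \<in> conj_point ` pair_fibre S1 S2 p" if "conj_point x \<in> pair_fibre S1 S2 p" for x
    using imageI[OF that, of conj_point] by simp
  then show ?thesis
    by (auto simp flip: conj_point_in_fibre_iff)
qed

lemma double_points_reverse:
  "double_points (reverse_orientation S1) (reverse_orientation S2) = double_points S1 S2"
  by (simp add: double_points_def pair_fibre_reverse card_image[OF inj_conj_point])

lemma pair_image_reverse:
  "pair_image (reverse_orientation S1) (reverse_orientation S2) = pair_image S1 S2"
  by (simp add: pair_image_eq reverse_image)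

lemma pair_tangent_reverse:
  assumes "circle_immersion S1" "circle_immersion S2" "x \<in> pair_fibre S1 S2 p"
  shows "pair_tangent (reverse_orientation S1) (reverse_orientation S2) (conj_point x)
    = - pair_tangent S1 S2 x"
  using assms by (cases x) (auto simp: pair_fibre_def pair_tangent_def circle_tangent_reverse)

text \<open>The quadrant of the reversed pair with signs \<open>- s\<close> is the quadrant of the original pair
  with signs \<open>s\<close>, because the tangents have changed sign as well.\<close>

lemma quadrant_region_reverse:
  assumes "circle_immersion S1" "circle_immersion S2"
  shows "quadrant_region (reverse_orientation S1) (reverse_orientation S2) p
      (\<lambda>x\<in>conj_point ` pair_fibre S1 S2 p. - s (conj_point x)) = quadrant_region S1 S2 p s"
proof -
  have "(\<Sum>x\<in>conj_point ` pair_fibre S1 S2 p.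
        (\<lambda>x\<in>conj_point ` pair_fibre S1 S2 p. - s (conj_point x)) x *\<^sub>R
          pair_tangent (reverse_orientation S1) (reverse_orientation S2) x)
      = (\<Sum>x\<in>pair_fibre S1 S2 p. s x *\<^sub>R pair_tangent S1 S2 x)"
    by (simp add: sum.reindex[OF inj_conj_point] pair_tangent_reverse[OF assms])
  then show ?thesis
    unfolding quadrant_region_def pair_image_reverse pair_fibre_reverse by simp
qed

lemma double_point_index_reverse:
  assumes gen: "generic_pair S1 S2" and p: "p \<in> double_points S1 S2"
  shows "double_point_index (reverse_orientation S1) (reverse_orientation S2) p
    = - double_point_index S1 S2 p"
proof -
  let ?R1 = "reverse_orientation S1" and ?R2 = "reverse_orientation S2"
  let ?F = "pair_fibre S1 S2 p"
  have imm: "circle_immersion S1" "circle_immersion S2"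
    using gen by (auto simp: generic_pair_def)
  have "(\<Sum>s\<in>quadrant_signs S1 S2 p. - real_of_int (pair_winding S1 S2 (quadrant_region S1 S2 p s)))
      = (\<Sum>s\<in>quadrant_signs ?R1 ?R2 p. real_of_int (pair_winding ?R1 ?R2 (quadrant_region ?R1 ?R2 p s)))"
  proof (rule sum.reindex_bij_witness[of _
        "\<lambda>s. \<lambda>x\<in>?F. - s (conj_point x)" "\<lambda>s. \<lambda>x\<in>conj_point ` ?F. - s (conj_point x)"])
    fix s assume s: "s \<in> quadrant_signs S1 S2 p"
    show "(\<lambda>x\<in>?F. - (\<lambda>x\<in>conj_point ` ?F. - s (conj_point x)) (conj_point x)) = s"
      using s by (auto simp: quadrant_signs_def fun_eq_iff restrict_def PiE_def extensional_def)
    show "(\<lambda>x\<in>conj_point ` ?F. - s (conj_point x)) \<in> quadrant_signs ?R1 ?R2 p"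
      using s by (fastforce simp: quadrant_signs_def pair_fibre_reverse PiE_def Pi_def)
    show "real_of_int (pair_winding ?R1 ?R2 (quadrant_region ?R1 ?R2 p
          (\<lambda>x\<in>conj_point ` ?F. - s (conj_point x))))
        = - real_of_int (pair_winding S1 S2 (quadrant_region S1 S2 p s))"
      using pair_winding_reverse[OF imm quadrant_region_in_components[OF gen p s]]
      by (simp add: quadrant_region_reverse[OF imm])
  next
    fix s assume s: "s \<in> quadrant_signs ?R1 ?R2 p"
    show "(\<lambda>x\<in>conj_point ` ?F. - (\<lambda>x\<in>?F. - s (conj_point x)) (conj_point x)) = s"
      using s by (auto simp: quadrant_signs_def pair_fibre_reverse fun_eq_iff restrict_def
          PiE_def extensional_def)
    show "(\<lambda>x\<in>?F. - s (conj_point x)) \<in> quadrant_signs S1 S2 p"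
      using s by (fastforce simp: quadrant_signs_def pair_fibre_reverse PiE_def Pi_def)
  qed
  then show ?thesis
    by (simp add: double_point_index_def sum_negf)
qed

theorem proposition2p11:
  fixes S1 S2 :: "complex \<Rightarrow> complex"
  assumes "generic_pair S1 S2"
  shows "J2plus (reverse_orientation S1) (reverse_orientation S2) = J2plus S1 S2"
proof -
  have imm: "circle_immersion S1" "circle_immersion S2"
    using assms by (auto simp: generic_pair_def)
  have "(real_of_int (encircling_index (reverse_orientation S1) (reverse_orientation S2)))\<^sup>2
      = (real_of_int (encircling_index S1 S2))\<^sup>2"
    using encircling_index_reverse[OF imm] by (metis of_int_power)
  then show ?thesis
    by (simp add: J2plus_def pair_image_reverse double_points_reverse pair_winding_reverse[OF imm]
        double_point_index_reverse[OF assms])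
qed

end
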